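(* Let $\mathcal{X}\subseteq L^0_c$ be non-empty, let $f\colon\mathcal{X}\to[-\infty,\infty]$, and let $\mathcal{C}\subseteq\mathcal{X}$ be non-empty. Suppose that $f$ and $\mathcal{C}$ are $\mathcal{P}$-sensitive and that there exists a joint reduction set $\mathcal{Q}$ for $f$ and $\mathcal{C}$. Let $(f^Q)_{Q\in\mathcal{Q}}$ be a $\mathcal{Q}$-localization of $f$. Moreover, suppose that, for each $Q\in\mathcal{Q}$, $X^*_Q\in\mathcal{X}$ is a solution to the problem of minimizing (respectively, for all $Q\in\mathcal{Q}$, maximizing) $f^Q(X)$ subject to $X\in\mathcal{C}$. Then any $\mathcal{Q}$-aggregator $X^*$ of the family $(X^*_Q)_{Q\in\mathcal{Q}}$ (if it exists) is a solution to the problem of minimizing (respectively maximizing) $f(X)$ subject to $X\in\mathcal{C}$.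
   Context: $(\Omega,\mathcal{F})$ is a measurable space and $\mathcal{P}$ is a non-empty set of probability measures on it; $c(A):=\sup_{P\in\mathcal{P}}P(A)$ for $A\in\mathcal{F}$. An event $A\in\mathcal{F}$ is $\mathcal{P}$-polar if $c(A)=0$; a property holds $\mathcal{P}$-q.s. if it holds outside a $\mathcal{P}$-polar event. $\mathfrak{P}_c(\Omega)$ is the set of probability measures on $(\Omega,\mathcal{F})$ vanishing on all $\mathcal{P}$-polar events. $L^0_c$ is the space of equivalence classes $[x]_c$ of real-valued random variables $x$ up to $\mathcal{P}$-q.s. equality. For $Q\in\mathfrak{P}_c(\Omega)$, $L^0_Q$ is the space of equivalence classes $[x]_Q$ up to $Q$-a.s. equality and $j_Q\colon L^0_c\to L^0_Q$, $[x]_c\mapsto[x]_Q$. A set $\mathcal{C}\subseteq\mathcal{X}$ is $\mathcal{P}$-sensitive if $\mathcal{C}=\emptyset$ or if for all $X\in\mathcal{X}$: $X\in\mathcal{C}\Leftrightarrow\forall Q\in\mathfrak{P}_c(\Omega)\colon j_Q(X)\in j_Q(\mathcal{C})$. A non-empty $\mathcal{Q}\subseteq\mathfrak{P}_c(\Omega)$ is a reduction set for $\mathcal{C}$ if for all $X\in\mathcal{X}$: $X\in\mathcal{C}\Leftrightarrow\forall Q\in\mathcal{Q}\colon j_Q(X)\in j_Q(\mathcal{C})$. With $E_r:=\{X\in\mathcal{X}\mid f(X)\le r\}$, $f$ is $\mathcal{P}$-sensitive if every $E_r$, $r\in\mathbb{R}$, is $\mathcal{P}$-sensitive, and $\mathcal{Q}$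 is a reduction set for $f$ if it is a reduction set for every $E_r$, $r\in\mathbb{R}$. A function $g\colon\mathcal{X}\to[-\infty,\infty]$ is $Q$-consistent if $j_Q(X)=j_Q(Y)$ implies $g(X)=g(Y)$ for $X,Y\in\mathcal{X}$. A $\mathcal{Q}$-localization of $f$ is a family $(f^Q)_{Q\in\mathcal{Q}}$ of functions $f^Q\colon\mathcal{X}\to[-\infty,\infty]$ such that each $f^Q$ is $Q$-consistent and $f(X)=\sup_{Q\in\mathcal{Q}}f^Q(X)$ for all $X\in\mathcal{X}$. A $\mathcal{Q}$-aggregator of a family $(X^Q)_{Q\in\mathcal{Q}}\subseteq\mathcal{X}$ is an element $X\in\mathcal{X}$ with $j_Q(X)=j_Q(X^Q)$ for all $Q\in\mathcal{Q}$. A solution to an optimization problem over $\mathcal{C}$ is an element of $\mathcal{C}$ attaining the minimum (maximum) over $\mathcal{C}$. *)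

theory Defs
  imports "HOL-Probability.Giry_Monad"
begin

text \<open>
  A measure \<open>M\<close> stands for the measurable space \<open>(space M, sets M)\<close>; its measure is never used.
  The set of all probability measures on that space is \<open>space (prob_algebra M)\<close>.
  Elements of \<open>L\<^sup>0\<close> spaces are equivalence classes, i.e. sets of measurable functions.
\<close>

definition upper_prob :: "'a measure set \<Rightarrow> 'a set \<Rightarrow> ennreal" where
  "upper_prob \<P> A = (SUP P\<in>\<P>. emeasure P A)"

definition polar :: "'a measure \<Rightarrow> 'a measure set \<Rightarrow> 'a set \<Rightarrow> bool" where
  "polar M \<P> A \<longleftrightarrow> A \<in> sets M \<and> upper_prob \<P> A = 0"

definition quasi_surely :: "'a measure \<Rightarrow> 'a measure set \<Rightarrow> ('a \<Rightarrow> bool) \<Rightarrow> bool" where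
  "quasi_surely M \<P> \<phi> \<longleftrightarrow> (\<exists>N. polar M \<P> N \<and> (\<forall>\<omega>\<in>space M - N. \<phi> \<omega>))"

definition Pc :: "'a measure \<Rightarrow> 'a measure set \<Rightarrow> 'a measure set" where
  "Pc M \<P> = {Q \<in> space (prob_algebra M). \<forall>A. polar M \<P> A \<longrightarrow> emeasure Q A = 0}"

definition qs_eq :: "'a measure \<Rightarrow> 'a measure set \<Rightarrow> (('a \<Rightarrow> real) \<times> ('a \<Rightarrow> real)) set" where
  "qs_eq M \<P> = {(x, y). x \<in> borel_measurable M \<and> y \<in> borel_measurable M
     \<and> quasi_surely M \<P> (\<lambda>\<omega>. x \<omega> = y \<omega>)}"

definition L0c :: "'a measure \<Rightarrow> 'a measure set \<Rightarrow> ('a \<Rightarrow> real) set set" where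
  "L0c M \<P> = borel_measurable M // qs_eq M \<P>"

definition as_eq :: "'a measure \<Rightarrow> (('a \<Rightarrow> real) \<times> ('a \<Rightarrow> real)) set" where
  "as_eq Q = {(x, y). x \<in> borel_measurable Q \<and> y \<in> borel_measurable Q
     \<and> (AE \<omega> in Q. x \<omega> = y \<omega>)}"

text \<open>
  For \<open>Q\<close> in \<open>Pc M \<P>\<close>, the union of the \<open>Q\<close>-classes of all representatives of \<open>[x]\<^sub>c\<close>
  is just \<open>[x]\<^sub>Q\<close>; see \<open>j_class\<close> below.
\<close>
definition j :: "'a measure \<Rightarrow> ('a \<Rightarrow> real) set \<Rightarrow> ('a \<Rightarrow> real) set" where
  "j Q X = as_eq Q `` X"

definition sensitive_set ::
  "'a measure \<Rightarrow> 'a measure set \<Rightarrow> ('a \<Rightarrow> real) set set \<Rightarrow> ('a \<Rightarrow> real) set set \<Rightarrow> bool" where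
  "sensitive_set M \<P> \<X> \<C> \<longleftrightarrow>
     \<C> = {} \<or> (\<forall>X\<in>\<X>. X \<in> \<C> \<longleftrightarrow> (\<forall>Q\<in>Pc M \<P>. j Q X \<in> j Q ` \<C>))"

definition reduction_set ::
  "'a measure \<Rightarrow> 'a measure set \<Rightarrow> ('a \<Rightarrow> real) set set \<Rightarrow> ('a \<Rightarrow> real) set set
    \<Rightarrow> 'a measure set \<Rightarrow> bool" where
  "reduction_set M \<P> \<X> \<C> \<Q> \<longleftrightarrow>
     \<Q> \<noteq> {} \<and> \<Q> \<subseteq> Pc M \<P> \<and> (\<forall>X\<in>\<X>. X \<in> \<C> \<longleftrightarrow> (\<forall>Q\<in>\<Q>. j Q X \<in> j Q ` \<C>))"

definition sublevel ::
  "('a \<Rightarrow> real) set set \<Rightarrow> (('a \<Rightarrow> real) set \<Rightarrow> ereal) \<Rightarrow> real \<Rightarrow> ('a \<Rightarrow> real) set set" where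
  "sublevel \<X> f r = {X \<in> \<X>. f X \<le> ereal r}"

definition sensitive_fun ::
  "'a measure \<Rightarrow> 'a measure set \<Rightarrow> ('a \<Rightarrow> real) set set \<Rightarrow> (('a \<Rightarrow> real) set \<Rightarrow> ereal) \<Rightarrow> bool" where
  "sensitive_fun M \<P> \<X> f \<longleftrightarrow> (\<forall>r. sensitive_set M \<P> \<X> (sublevel \<X> f r))"

definition reduction_set_fun ::
  "'a measure \<Rightarrow> 'a measure set \<Rightarrow> ('a \<Rightarrow> real) set set \<Rightarrow> (('a \<Rightarrow> real) set \<Rightarrow> ereal)
    \<Rightarrow> 'a measure set \<Rightarrow> bool" where
  "reduction_set_fun M \<P> \<X> f \<Q> \<longleftrightarrow> (\<forall>r. reduction_set M \<P> \<X> (sublevel \<X> f r) \<Q>)"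

definition consistent ::
  "('a \<Rightarrow> real) set set \<Rightarrow> 'a measure \<Rightarrow> (('a \<Rightarrow> real) set \<Rightarrow> ereal) \<Rightarrow> bool" where
  "consistent \<X> Q g \<longleftrightarrow> (\<forall>X\<in>\<X>. \<forall>Y\<in>\<X>. j Q X = j Q Y \<longrightarrow> g X = g Y)"

definition localization ::
  "('a \<Rightarrow> real) set set \<Rightarrow> 'a measure set \<Rightarrow> (('a \<Rightarrow> real) set \<Rightarrow> ereal)
    \<Rightarrow> ('a measure \<Rightarrow> ('a \<Rightarrow> real) set \<Rightarrow> ereal) \<Rightarrow> bool" where
  "localization \<X> \<Q> f F \<longleftrightarrow>
     (\<forall>Q\<in>\<Q>. consistent \<X> Q (F Q)) \<and> (\<forall>X\<in>\<X>. f X = (SUP Q\<in>\<Q>. F Q X))"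

definition aggregator ::
  "('a \<Rightarrow> real) set set \<Rightarrow> 'a measure set \<Rightarrow> ('a measure \<Rightarrow> ('a \<Rightarrow> real) set)
    \<Rightarrow> ('a \<Rightarrow> real) set \<Rightarrow> bool" where
  "aggregator \<X> \<Q> Xs X \<longleftrightarrow> X \<in> \<X> \<and> (\<forall>Q\<in>\<Q>. j Q X = j Q (Xs Q))"

lemma equiv_as_eq: "equiv (borel_measurable Q) (as_eq Q)"
  unfolding as_eq_def
  by (rule equivI) (auto simp: refl_on_def sym_def trans_def eq_commute elim: AE_mp)

lemma Pc_AE:
  assumes "Q \<in> Pc M \<P>" "quasi_surely M \<P> \<phi>"
  shows "AE \<omega> in Q. \<phi> \<omega>"
proof -
  obtain N where N: "polar M \<P> N" "\<forall>\<omega>\<in>space M - N. \<phi> \<omega>"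
    using assms(2) unfolding quasi_surely_def by auto
  have "sets Q = sets M" "emeasure Q N = 0"
    using assms(1) N(1) by (auto simp: Pc_def space_prob_algebra)
  then have "N \<in> null_sets Q" "space Q = space M"
    using N(1) by (auto simp: polar_def null_sets_def dest: sets_eq_imp_space_eq)
  then show ?thesis
    using N(2) by (intro AE_I'[of N]) auto
qed

lemma quasi_surely_refl: "quasi_surely M \<P> (\<lambda>\<omega>. x \<omega> = x \<omega>)"
  unfolding quasi_surely_def polar_def upper_prob_def
  by (intro exI[of _ "{}"]) (auto simp: SUP_constant bot_ennreal)

lemma j_class:
  assumes Q: "Q \<in> Pc M \<P>" and x: "x \<in> borel_measurable M"
  shows "j Q (qs_eq M \<P> `` {x}) = as_eq Q `` {x}"
proof -
  have sQ: "sets Q = sets M"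
    using Q by (simp add: Pc_def space_prob_algebra)
  have sub: "qs_eq M \<P> \<subseteq> as_eq Q"
    using Pc_AE[OF Q] measurable_cong_sets[OF sQ refl, of borel]
    by (auto simp: qs_eq_def as_eq_def)
  have "(x, x) \<in> qs_eq M \<P>"
    using x quasi_surely_refl by (simp add: qs_eq_def)
  moreover have "trans (as_eq Q)"
    using equiv_as_eq by (auto simp: equiv_def)
  ultimately show ?thesis
    using sub unfolding j_def by (auto dest: transD)
qed

end

theory Submission
  imports Defs
begin

text \<open>
  An aggregator \<open>X\<close> of the local solutions \<open>Xs Q\<close> is indistinguishable from \<open>Xs Q\<close> under each
  \<open>Q\<close> in the reduction set. Both ingredients of the problem see an element only through these
  local views: membership in \<open>\<C>\<close> because \<open>\<Q>\<close> is a reduction set for \<open>\<C>\<close>, and the value of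
  \<open>f\<close> because it is the supremum of the consistent functions \<open>F Q\<close>. Hence \<open>X\<close> is feasible
  (\<open>aggregator_in_reduced_set\<close>) and simultaneously takes the optimal value of every local problem
  (\<open>localization_at_aggregator\<close>). Suprema are monotone, so comparing \<open>F Q X\<close> with \<open>F Q Y\<close> for
  every \<open>Q\<close> compares \<open>f X\<close> with \<open>f Y\<close> in the same direction; this is why minimization and
  maximization are treated alike.
\<close>

text \<open>
  A reduction set decides membership by local views alone, and each local view of \<open>X\<close> is that of
  some element of \<open>\<C>\<close>, which may vary with \<open>Q\<close>.
\<close>
lemma aggregator_in_reduced_set:
  assumes "reduction_set M \<P> \<X> \<C> \<Q>"
    and "aggregator \<X> \<Q> Xs X"
    and "\<And>Q. Q \<in> \<Q> \<Longrightarrow> Xs Q \<in> \<C>"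
  shows "X \<in> \<C>"
  using assms unfolding reduction_set_def aggregator_def by blast

lemma localization_at_aggregator:
  assumes "localization \<X> \<Q> f F"
    and "aggregator \<X> \<Q> Xs X"
    and "Q \<in> \<Q>" and "Xs Q \<in> \<X>"
  shows "F Q X = F Q (Xs Q)"
  using assms unfolding localization_def aggregator_def consistent_def by blast

lemma localization_mono:
  assumes "localization \<X> \<Q> f F" and "X \<in> \<X>" and "Y \<in> \<X>"
    and "\<And>Q. Q \<in> \<Q> \<Longrightarrow> F Q X \<le> F Q Y"
  shows "f X \<le> f Y"
  using assms unfolding localization_def by (auto intro: SUP_mono)

theorem proposition4p1:
  fixes M :: "'a measure"
    and \<P> \<Q> :: "'a measure set"
    and \<X> \<C> :: "('a \<Rightarrow> real) set set"
    and f :: "('a \<Rightarrow> real) set \<Rightarrow> ereal"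
    and F :: "'a measure \<Rightarrow> ('a \<Rightarrow> real) set \<Rightarrow> ereal"
    and Xs :: "'a measure \<Rightarrow> ('a \<Rightarrow> real) set"
    and X :: "('a \<Rightarrow> real) set"
  assumes "\<P> \<noteq> {}" and "\<P> \<subseteq> space (prob_algebra M)"
    and "\<X> \<noteq> {}" and "\<X> \<subseteq> L0c M \<P>"
    and "\<C> \<noteq> {}" and "\<C> \<subseteq> \<X>"
    and "sensitive_fun M \<P> \<X> f" and "sensitive_set M \<P> \<X> \<C>"
    and "reduction_set_fun M \<P> \<X> f \<Q>" and "reduction_set M \<P> \<X> \<C> \<Q>"
    and "localization \<X> \<Q> f F"
    and "\<forall>Q\<in>\<Q>. Xs Q \<in> \<X>"
    and "aggregator \<X> \<Q> Xs X"
  shows "((\<forall>Q\<in>\<Q>. is_arg_min (F Q) (\<lambda>Y. Y \<in> \<C>) (Xs Q)) \<longrightarrow> is_arg_min f (\<lambda>Y. Y \<in> \<C>) X) \<and>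
         ((\<forall>Q\<in>\<Q>. is_arg_max (F Q) (\<lambda>Y. Y \<in> \<C>) (Xs Q)) \<longrightarrow> is_arg_max f (\<lambda>Y. Y \<in> \<C>) X)"
proof (intro conjI impI)
  note agg = \<open>aggregator \<X> \<Q> Xs X\<close>
  note loc = \<open>localization \<X> \<Q> f F\<close>
  have X: "X \<in> \<X>"
    using agg by (simp add: aggregator_def)
  have local_value: "F Q X = F Q (Xs Q)" if "Q \<in> \<Q>" for Q
    using localization_at_aggregator[OF loc agg that] \<open>\<forall>Q\<in>\<Q>. Xs Q \<in> \<X>\<close> that by blast
  note feasible = aggregator_in_reduced_set[OF \<open>reduction_set M \<P> \<X> \<C> \<Q>\<close> agg]
  show "is_arg_min f (\<lambda>Y. Y \<in> \<C>) X"
    if sol: "\<forall>Q\<in>\<Q>. is_arg_min (F Q) (\<lambda>Y. Y \<in> \<C>) (Xs Q)"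
  proof -
    have "X \<in> \<C>"
      using sol by (intro feasible) (simp add: is_arg_min_linorder)
    moreover have "f X \<le> f Y" if "Y \<in> \<C>" for Y
      using sol local_value that \<open>\<C> \<subseteq> \<X>\<close>
      by (intro localization_mono[OF loc X]) (auto simp: is_arg_min_linorder)
    ultimately show ?thesis
      by (simp add: is_arg_min_linorder)
  qed
  show "is_arg_max f (\<lambda>Y. Y \<in> \<C>) X"
    if sol: "\<forall>Q\<in>\<Q>. is_arg_max (F Q) (\<lambda>Y. Y \<in> \<C>) (Xs Q)"
  proof -
    have "X \<in> \<C>"
      using sol by (intro feasible) (simp add: is_arg_max_linorder)
    moreover have "f Y \<le> f X" if "Y \<in> \<C>" for Y
      using sol local_value that \<open>\<C> \<subseteq> \<X>\<close>
      by (intro localization_mono[OF loc _ X]) (auto simp: is_arg_max_linorder)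
    ultimately show ?thesis
      by (simp add: is_arg_max_linorder)
  qed
qed

end
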